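(* The van der Waerden ideal $\mathcal{W}$ on $\omega$ contains no cotowers.
   Context: $A\subseteq^* B$ means that $A\setminus B$ is finite. Ideals on a countably infinite set $\Omega$ are assumed to be proper and to contain all finite subsets of $\Omega$. A tower on $\Omega$ is a sequence $(T_\alpha)_{\alpha<\kappa}$ of infinite subsets of $\Omega$, with $\kappa$ a cardinal, such that $T_\beta\subseteq^* T_\alpha$ whenever $\alpha\le\beta<\kappa$, and which has no pseudointersection, i.e. there is no infinite $X\subseteq\Omega$ with $X\subseteq^* T_\alpha$ for all $\alpha<\kappa$. A cotower in an ideal $\mathcal{I}$ on $\Omega$ is a sequence $(A_\alpha)_{\alpha<\kappa}$ of elements of $\mathcal{I}$ such that $(\Omega\setminus A_\alpha)_{\alpha<\kappa}$ is a tower. The van der Waerden ideal is $\mathcal{W}=\{A\subseteq\omega: A \text{ does not contain arbitrarily long (finite) arithmetic progressions}\}$ (a proper ideal by van der Waerden's theorem). *)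

theory Defs
  imports Main
begin

definition almost_subset :: "'a set \<Rightarrow> 'a set \<Rightarrow> bool" (infix "\<subseteq>\<^sup>*" 50) where
  "A \<subseteq>\<^sup>* B \<longleftrightarrow> finite (A - B)"

definition pseudointersection :: "'a set \<Rightarrow> 'k set \<Rightarrow> ('k \<Rightarrow> 'a set) \<Rightarrow> 'a set \<Rightarrow> bool" where
  "pseudointersection \<Omega> K T X \<longleftrightarrow> infinite X \<and> X \<subseteq> \<Omega> \<and> (\<forall>\<alpha>\<in>K. X \<subseteq>\<^sup>* T \<alpha>)"

(* A cardinal is an initial well-order \<kappa>, i.e. Card_order \<kappa>: the ordinals below it are the
   elements of Field \<kappa>, and \<alpha> \<le> \<beta> is (\<alpha>, \<beta>) \<in> \<kappa>.  Leaving the type 'k arbitrary covers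
   cardinals of every size. *)
definition tower :: "'a set \<Rightarrow> 'k rel \<Rightarrow> ('k \<Rightarrow> 'a set) \<Rightarrow> bool" where
  "tower \<Omega> \<kappa> T \<longleftrightarrow>
     Card_order \<kappa> \<and>
     (\<forall>\<alpha>\<in>Field \<kappa>. T \<alpha> \<subseteq> \<Omega> \<and> infinite (T \<alpha>)) \<and>
     (\<forall>\<alpha> \<beta>. (\<alpha>, \<beta>) \<in> \<kappa> \<longrightarrow> T \<beta> \<subseteq>\<^sup>* T \<alpha>) \<and>
     \<not> (\<exists>X. pseudointersection \<Omega> (Field \<kappa>) T X)"

definition cotower :: "'a set \<Rightarrow> 'a set set \<Rightarrow> 'k rel \<Rightarrow> ('k \<Rightarrow> 'a set) \<Rightarrow> bool" where
  "cotower \<Omega> \<I> \<kappa> A \<longleftrightarrow>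
     (\<forall>\<alpha>\<in>Field \<kappa>. A \<alpha> \<in> \<I>) \<and> tower \<Omega> \<kappa> (\<lambda>\<alpha>. \<Omega> - A \<alpha>)"

definition arith_progression :: "nat \<Rightarrow> nat \<Rightarrow> nat \<Rightarrow> nat set" where
  "arith_progression a d l = {a + i * d | i. i < l}"

definition van_der_Waerden_ideal :: "nat set set" where
  "van_der_Waerden_ideal =
     {A. \<not> (\<forall>l. \<exists>a d. d > 0 \<and> arith_progression a d l \<subseteq> A)}"

end

(* Suppose a cotower A exists, so that every infinite set has infinite intersection with some
   A \<alpha>.  Applying this to the dilates of a shrinking sequence of sets yields infinite sets
   D 0 \<supseteq> D 1 \<supseteq> ... and indices \<alpha> 0, \<alpha> 1, ... such that (n + 1) * d belongs to A (\<alpha> n) for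
   all d in D (n + 1).  Some infinite X is almost disjoint from all the sets A (\<alpha> n), whereas
   X meets some A \<beta> in an infinite set; hence \<beta> bounds all the \<alpha> n, and A \<beta> almost contains
   every A (\<alpha> n).  All but finitely many d in D l therefore satisfy d, 2d, ..., ld \<in> A \<beta>, so
   A \<beta> contains arbitrarily long arithmetic progressions. *)
theory Submission imports Defs begin

lemma almost_subset_trans:
  assumes "A \<subseteq>\<^sup>* B" and "B \<subseteq>\<^sup>* C"
  shows "A \<subseteq>\<^sup>* C"
proof -
  have "A - C \<subseteq> (A - B) \<union> (B - C)" by blast
  then show ?thesis
    using assms unfolding almost_subset_def by (meson finite_UnI finite_subset)
qed

text \<open>Induction on \<open>n\<close>: of the set \<open>T m\<close> found so far and the new
  set \<open>T (Suc n)\<close>, the one almost contained in the other serves as the next witness.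
  The indices need not follow the order of the chain.\<close>

lemma almost_subset_Inter_of_chain:
  fixes T :: "nat \<Rightarrow> 'a set"
  assumes chain: "\<And>i j. T i \<subseteq>\<^sup>* T j \<or> T j \<subseteq>\<^sup>* T i"
  shows "\<exists>m. T m \<subseteq>\<^sup>* (\<Inter>i\<le>n. T i)"
proof (induction n)
  case 0
  then show ?case by (auto simp: almost_subset_def intro!: exI[of _ 0])
next
  case (Suc n)
  then obtain m where m: "T m \<subseteq>\<^sup>* (\<Inter>i\<le>n. T i)" by blast
  have *: "T k \<subseteq>\<^sup>* (\<Inter>i\<le>Suc n. T i)"
    if "T k \<subseteq>\<^sup>* (\<Inter>i\<le>n. T i)" "T k \<subseteq>\<^sup>* T (Suc n)" for k
  proof -
    have "T k - (\<Inter>i\<le>Suc n. T i) = (T k - (\<Inter>i\<le>n. T i)) \<union> (T k - T (Suc n))"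
      by (auto simp: atMost_Suc)
    then show ?thesis using that by (simp add: almost_subset_def)
  qed
  have refl: "T k \<subseteq>\<^sup>* T k" for k by (simp add: almost_subset_def)
  show ?case
    using chain[of m "Suc n"] *[of m] *[of "Suc n"] m refl almost_subset_trans by blast
qed

text \<open>Diagonalisation: every finite intersection is infinite because it almost contains some
  \<open>T m\<close>, so a strictly increasing \<open>f\<close> can be chosen with
  \<open>f n\<close> in the first \<open>n + 1\<close> sets at once.\<close>

lemma chain_has_pseudointersection:
  fixes T :: "nat \<Rightarrow> nat set"
  assumes inf: "\<And>n. infinite (T n)"
    and chain: "\<And>i j. T i \<subseteq>\<^sup>* T j \<or> T j \<subseteq>\<^sup>* T i"
  shows "\<exists>X. infinite X \<and> (\<forall>n. X \<subseteq>\<^sup>* T n)"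
proof -
  have "infinite (\<Inter>i\<le>n. T i)" for n
  proof
    assume fin: "finite (\<Inter>i\<le>n. T i)"
    obtain m where "T m \<subseteq>\<^sup>* (\<Inter>i\<le>n. T i)"
      using almost_subset_Inter_of_chain[of T n, OF chain] by blast
    then have "finite (T m)" using fin by (simp add: almost_subset_def)
    with inf show False by blast
  qed
  then have "\<exists>x\<in>(\<Inter>i\<le>n. T i). y < x" for n y
    unfolding finite_nat_set_iff_bounded_le by (meson not_le)
  then have "\<exists>f. \<forall>n. f n \<in> (\<Inter>i\<le>n. T i) \<and> f n < f (Suc n)"
    by (intro dependent_nat_choice) blast+
  then obtain f where f: "\<And>n. f n \<in> (\<Inter>i\<le>n. T i)" and less: "\<And>n. f n < f (Suc n)"
    by blast
  have "inj f" using less by (intro strict_mono_imp_inj_on) (simp add: strict_mono_Suc_iff)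
  then have "infinite (range f)" by (simp add: finite_image_iff)
  moreover have "range f \<subseteq>\<^sup>* T n" for n
  proof -
    \<comment> \<open>From index \<open>n\<close> on, every value of \<open>f\<close> lies in
      \<open>T n\<close>; only the first \<open>n\<close> values can escape.\<close>
    have "range f - T n \<subseteq> f ` {..<n}"
      using f by (force simp: not_le[symmetric])
    then show ?thesis
      unfolding almost_subset_def by (rule finite_subset) simp
  qed
  ultimately show ?thesis by blast
qed

text \<open>Dilation by \<open>Suc k\<close> is injective, so for each \<open>k < l\<close> only
  finitely many \<open>d\<close> in \<open>D\<close> have their multiple outside \<open>B\<close>.
  Any other positive \<open>d\<close> gives the progression d, 2d, ..., ld, whose first term equals
  its difference.\<close>

lemma arith_progression_subset_of_dilates:
  assumes inf: "infinite D"
    and dil: "\<And>k. k < l \<Longrightarrow> (\<lambda>d. Suc k * d) ` D \<subseteq>\<^sup>* B"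
  shows "\<exists>a d. d > 0 \<and> arith_progression a d l \<subseteq> B"
proof -
  have fin: "finite {d \<in> D. Suc k * d \<notin> B}" if "k < l" for k
  proof (rule finite_imageD)
    have "(\<lambda>d. Suc k * d) ` {d \<in> D. Suc k * d \<notin> B} \<subseteq> (\<lambda>d. Suc k * d) ` D - B"
      by blast
    then show "finite ((\<lambda>d. Suc k * d) ` {d \<in> D. Suc k * d \<notin> B})"
      using dil[OF that] unfolding almost_subset_def by (rule finite_subset)
    show "inj_on (\<lambda>d. Suc k * d) {d \<in> D. Suc k * d \<notin> B}"
      by (intro inj_onI) (simp only: mult_cancel1, simp)
  qed
  \<comment> \<open>Removing 0 as well keeps the common difference positive.\<close>
  have "infinite (D - insert 0 (\<Union>k<l. {d \<in> D. Suc k * d \<notin> B}))"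
    using inf fin by (intro Diff_infinite_finite) auto
  from infinite_imp_nonempty[OF this] obtain d where d: "d \<in> D - insert 0 (\<Union>k<l. {d \<in> D. Suc k * d \<notin> B})"
    unfolding ex_in_conv[symmetric] by (elim exE)
  have "Suc k * d \<in> B" if "k < l" for k
    using that d by fast
  then have "arith_progression d d l \<subseteq> B"
    by (auto simp: arith_progression_def)
  moreover have "d > 0" using d by (cases d) simp_all
  ultimately show ?thesis by blast
qed

text \<open>Dependent choice: the dilate of \<open>D n\<close> by \<open>Suc n\<close> is infinite,
  hence meets some member of the family in an infinite set, and \<open>D (Suc n)\<close> is the part
  of \<open>D n\<close> that is sent into that member.\<close>

lemma dilates_in_tall_family:
  fixes A :: "'k \<Rightarrow> nat set"
  assumes tall: "\<And>X. infinite X \<Longrightarrow> \<exists>\<alpha>\<in>K. infinite (X \<inter> A \<alpha>)"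
  shows "\<exists>D \<alpha>. \<forall>n. infinite (D n) \<and> D (Suc n) \<subseteq> D n \<and> \<alpha> n \<in> K \<and>
           (\<lambda>d. Suc n * d) ` D (Suc n) \<subseteq> A (\<alpha> n)"
proof -
  have "\<exists>D. \<forall>n. infinite (D n) \<and>
          (D (Suc n) \<subseteq> D n \<and> (\<exists>\<alpha>\<in>K. (\<lambda>d. Suc n * d) ` D (Suc n) \<subseteq> A \<alpha>))"
  proof (rule dependent_nat_choice)
    show "\<exists>D::nat set. infinite D" using infinite_UNIV_nat by blast
  next
    fix D :: "nat set" and n
    assume D: "infinite D"
    have "inj_on (\<lambda>d. Suc n * d) D"
      by (intro inj_onI) (simp only: mult_cancel1, simp)
    then have "infinite ((\<lambda>d. Suc n * d) ` D)"
      using D by (simp only: finite_image_iff not_False_eq_True)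
    then obtain \<alpha> where \<alpha>: "\<alpha> \<in> K" "infinite ((\<lambda>d. Suc n * d) ` D \<inter> A \<alpha>)"
      using tall by blast
    let ?E = "{d \<in> D. Suc n * d \<in> A \<alpha>}"
    have "(\<lambda>d. Suc n * d) ` ?E = (\<lambda>d. Suc n * d) ` D \<inter> A \<alpha>" by blast
    then have "infinite ?E" using \<alpha>(2) finite_imageI by metis
    moreover have "?E \<subseteq> D" "(\<lambda>d. Suc n * d) ` ?E \<subseteq> A \<alpha>" by auto
    ultimately show "\<exists>E. infinite E \<and> (E \<subseteq> D \<and> (\<exists>\<alpha>\<in>K. (\<lambda>d. Suc n * d) ` E \<subseteq> A \<alpha>))"
      using \<alpha>(1) by blast
  qed
  then show ?thesis by metis
qed

theorem mainTheorem2: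
  fixes \<kappa> :: "'k rel" and A :: "'k \<Rightarrow> nat set"
  shows "\<not> cotower UNIV van_der_Waerden_ideal \<kappa> A"
proof
  assume "cotower UNIV van_der_Waerden_ideal \<kappa> A"
  then have vdW: "\<And>\<alpha>. \<alpha> \<in> Field \<kappa> \<Longrightarrow> A \<alpha> \<in> van_der_Waerden_ideal"
    and card: "Card_order \<kappa>"
    and inf: "\<And>\<alpha>. \<alpha> \<in> Field \<kappa> \<Longrightarrow> infinite (- A \<alpha>)"
    and desc: "\<And>\<alpha> \<beta>. (\<alpha>, \<beta>) \<in> \<kappa> \<Longrightarrow> - A \<beta> \<subseteq>\<^sup>* - A \<alpha>"
    and nopseudo: "\<not> (\<exists>X. pseudointersection UNIV (Field \<kappa>) (\<lambda>\<alpha>. - A \<alpha>) X)"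
    unfolding cotower_def tower_def Compl_eq_Diff_UNIV by auto
  have asc: "A \<alpha> \<subseteq>\<^sup>* A \<beta>" if "(\<alpha>, \<beta>) \<in> \<kappa>" for \<alpha> \<beta>
  proof -
    have "A \<alpha> - A \<beta> = - A \<beta> - - A \<alpha>" by blast
    then show ?thesis using desc[OF that] by (simp add: almost_subset_def)
  qed
  have total: "(\<alpha>, \<beta>) \<in> \<kappa> \<or> (\<beta>, \<alpha>) \<in> \<kappa>" if "\<alpha> \<in> Field \<kappa>" "\<beta> \<in> Field \<kappa>" for \<alpha> \<beta>
  proof -
    have "Total \<kappa>" "Refl \<kappa>"
      using card_order_on_well_order_on[OF card]
      by (auto simp: well_order_on_def linear_order_on_def partial_order_on_def preorder_on_def)
    then show ?thesis using that unfolding total_on_def refl_on_def by metis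
  qed
  \<comment> \<open>An infinite \<open>X\<close> having finite intersection with every
    \<open>A \<alpha>\<close> would be a pseudointersection of the complements.\<close>
  have tall: "\<exists>\<alpha>\<in>Field \<kappa>. infinite (X \<inter> A \<alpha>)" if "infinite X" for X
    using nopseudo that unfolding pseudointersection_def almost_subset_def
    by (auto simp: Diff_eq)
  obtain D \<alpha> where Dinf: "\<And>n. infinite (D n)" and Dsub: "\<And>n. D (Suc n) \<subseteq> D n"
    and \<alpha>: "\<And>n. \<alpha> n \<in> Field \<kappa>" and dil: "\<And>n. (\<lambda>d. Suc n * d) ` D (Suc n) \<subseteq> A (\<alpha> n)"
    using dilates_in_tall_family[of "Field \<kappa>" A, OF tall] by metis
  \<comment> \<open>The chosen \<open>\<alpha> n\<close> need not increase, but totality of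
    \<open>\<kappa>\<close> makes their complements a countable chain under almost
    inclusion.\<close>
  obtain X where X: "infinite X" "\<And>n. X \<subseteq>\<^sup>* - A (\<alpha> n)"
  proof -
    have "- A (\<alpha> i) \<subseteq>\<^sup>* - A (\<alpha> j) \<or> - A (\<alpha> j) \<subseteq>\<^sup>* - A (\<alpha> i)" for i j
      using total[OF \<alpha>[of i] \<alpha>[of j]] desc by blast
    then show ?thesis
      using chain_has_pseudointersection[of "\<lambda>n. - A (\<alpha> n)"] inf[OF \<alpha>] that by blast
  qed
  obtain \<beta> where \<beta>: "\<beta> \<in> Field \<kappa>" "infinite (X \<inter> A \<beta>)"
    using tall X(1) by blast
  \<comment> \<open>Otherwise \<open>\<beta>\<close> lies below some \<open>\<alpha> n\<close>, and
    \<open>X\<close>, being almost disjoint from \<open>A (\<alpha> n)\<close>, would be almost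
    disjoint from \<open>A \<beta>\<close>.\<close>
  have bound: "A (\<alpha> n) \<subseteq>\<^sup>* A \<beta>" for n
  proof (rule ccontr)
    assume "\<not> A (\<alpha> n) \<subseteq>\<^sup>* A \<beta>"
    then have "(\<beta>, \<alpha> n) \<in> \<kappa>" using asc total \<alpha> \<beta>(1) by blast
    then have "X \<subseteq>\<^sup>* - A \<beta>" using X(2) desc almost_subset_trans by blast
    with \<beta>(2) show False by (simp add: almost_subset_def Diff_eq)
  qed
  have "\<exists>a d. d > 0 \<and> arith_progression a d l \<subseteq> A \<beta>" for l
  proof (rule arith_progression_subset_of_dilates)
    show "infinite (D l)" by (rule Dinf)
    fix k assume "k < l"
    \<comment> \<open>As \<open>Suc k \<le> l\<close>, the single set \<open>D l\<close> serves all
      the dilation factors 1, ..., l.\<close>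
    then have "D l \<subseteq> D (Suc k)" using lift_Suc_antimono_le[of D] Dsub by simp
    then have "(\<lambda>d. Suc k * d) ` D l \<subseteq> A (\<alpha> k)" using dil by blast
    then have "(\<lambda>d. Suc k * d) ` D l \<subseteq>\<^sup>* A (\<alpha> k)"
      by (simp only: almost_subset_def Diff_eq_empty_iff[THEN iffD2] finite.emptyI)
    then show "(\<lambda>d. Suc k * d) ` D l \<subseteq>\<^sup>* A \<beta>"
      using bound by (rule almost_subset_trans)
  qed
  then show False using vdW[OF \<beta>(1)] unfolding van_der_Waerden_ideal_def by blast
qed

end
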